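(* Let $X$ be a compact Hausdorff space, let $C(X)$ be the space of complex-valued continuous functions on $X$ with the supremum norm, and let $\mu_1,\mu_2,\mu_3$ be finite real-valued Borel measures on $X$. Let $\mathcal{L}:C(X)\to\mathbb{C}^3/\mathbb{C}\mathbf{1}$ be the linear operator $$\mathcal{L}f:=\Bigl(\int_Xf\,d\mu_1,\int_Xf\,d\mu_2,\int_Xf\,d\mu_3\Bigr)+\mathbb{C}\mathbf{1}.$$ Then $$\|\mathcal{L}\|_{C(X)\to\mathbb{C}^3/\mathbb{C}\mathbf{1}}=\frac12\max_{1\le j,k\le3}\|\mu_j-\mu_k\|.$$
   Context: Here $\mathbf{1}=(1,1,1)\in\mathbb{C}^3$, and $\mathbb{C}^3/\mathbb{C}\mathbf{1}$ carries the quotient norm $\|(a,b,c)+\mathbb{C}\mathbf{1}\|_\infty=\min_{\lambda\in\mathbb{C}}\max\{|a-\lambda|,|b-\lambda|,|c-\lambda|\}$. For a finite real-valued Borel measure $\mu$ on $X$, $\|\mu\|$ denotes the norm of the functional $f\mapsto\int_Xf\,d\mu$ on $C(X)$, i.e. $\|\mu\|=\sup\{|\int_Xf\,d\mu|:f\in C(X),\ \sup_X|f|\le1\}$ (which is the total variation norm under the usual identification of $C(X)^*$ with measures). *)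

theory Defs
  imports "HOL-Analysis.Analysis"
begin

definition borel_sets :: "'a topology \<Rightarrow> 'a set set" where
  "borel_sets X = sigma_sets (topspace X) {U. openin X U}"

text \<open>Finite real-valued (signed) Borel measures are countably additive set functions; their values
  outside \<open>borel_sets X\<close> are irrelevant. No regularity is required.\<close>

definition real_borel_measure :: "'a topology \<Rightarrow> ('a set \<Rightarrow> real) \<Rightarrow> bool" where
  "real_borel_measure X \<mu> \<longleftrightarrow> \<mu> {} = 0 \<and>
     (\<forall>A :: nat \<Rightarrow> 'a set. range A \<subseteq> borel_sets X \<longrightarrow> disjoint_family A \<longrightarrow>
        (\<lambda>i. \<mu> (A i)) sums \<mu> (\<Union>i. A i))"

text \<open>The positive part of the Jordan decomposition. For a real-valued Borel measure the supremum
  is finite and defines a finite positive measure; the negative part is the positive part of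
  \<open>- \<mu>\<close>.\<close>

definition pos_variation :: "'a topology \<Rightarrow> ('a set \<Rightarrow> real) \<Rightarrow> 'a set \<Rightarrow> real" where
  "pos_variation X \<mu> A = (SUP B\<in>{B \<in> borel_sets X. B \<subseteq> A}. \<mu> B)"

definition pos_part_measure :: "'a topology \<Rightarrow> ('a set \<Rightarrow> real) \<Rightarrow> 'a measure" where
  "pos_part_measure X \<mu> =
     measure_of (topspace X) {U. openin X U} (\<lambda>A. ennreal (pos_variation X \<mu> A))"

definition signed_integral ::
    "'a topology \<Rightarrow> ('a set \<Rightarrow> real) \<Rightarrow> ('a \<Rightarrow> complex) \<Rightarrow> complex" where
  "signed_integral X \<mu> f =
     integral\<^sup>L (pos_part_measure X \<mu>) f - integral\<^sup>L (pos_part_measure X (- \<mu>)) f"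

text \<open>The closed unit ball of \<open>C(X)\<close>. Stating the bound pointwise avoids the supremum
  of the empty set when \<open>X\<close> is empty.\<close>

definition C_unit_ball :: "'a topology \<Rightarrow> ('a \<Rightarrow> complex) set" where
  "C_unit_ball X = {f. continuous_map X euclidean f \<and> (\<forall>x\<in>topspace X. cmod (f x) \<le> 1)}"

text \<open>The norm of an operator \<open>T\<close> on \<open>C(X)\<close> whose codomain is normed by \<open>N\<close>.\<close>

definition C_op_norm :: "'a topology \<Rightarrow> ('b \<Rightarrow> real) \<Rightarrow> (('a \<Rightarrow> complex) \<Rightarrow> 'b) \<Rightarrow> real" where
  "C_op_norm X N T = (SUP f\<in>C_unit_ball X. N (T f))"

definition measure_norm :: "'a topology \<Rightarrow> ('a set \<Rightarrow> real) \<Rightarrow> real" where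
  "measure_norm X \<mu> = C_op_norm X cmod (signed_integral X \<mu>)"

text \<open>The elements of the quotient of \<open>complex ^ 3\<close> by the multiples of \<open>(1, 1, 1)\<close> are cosets.\<close>

definition coset_one :: "complex ^ 3 \<Rightarrow> (complex ^ 3) set" where
  "coset_one v = {v + z *s 1 | z. True}"

text \<open>The library's \<open>infnorm\<close> on \<open>complex ^ 3\<close> is the maximum over real and imaginary
  parts, hence not the norm needed here.\<close>

definition max_norm :: "complex ^ 3 \<Rightarrow> real" where
  "max_norm v = (MAX i. cmod (v $ i))"

text \<open>As the members of the coset of \<open>(a, b, c)\<close> are the vectors
  \<open>(a - z, b - z, c - z)\<close>, and the infimum is attained, this is
  the minimum over \<open>z\<close> of \<open>max {|a - z|, |b - z|, |c - z|}\<close>.\<close>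

definition quotient_norm :: "(complex ^ 3) set \<Rightarrow> real" where
  "quotient_norm q = (INF w\<in>q. max_norm w)"

definition integral_triple ::
    "'a topology \<Rightarrow> (3 \<Rightarrow> 'a set \<Rightarrow> real) \<Rightarrow> ('a \<Rightarrow> complex) \<Rightarrow> (complex ^ 3) set" where
  "integral_triple X \<mu> f = coset_one (\<chi> j. signed_integral X (\<mu> j) f)"

end

theory Submission
  imports Defs
begin

text \<open>
  The lower bound is the triangle inequality in the quotient. For the upper bound, the quotient norm
  of \<open>(a, b, c)\<close>, the radius of the smallest enclosing disc, equals \<open>|w1 a + w2 b + w3 c|\<close> for some
  weights with \<open>w1 + w2 + w3 = 0\<close> and \<open>|w1| + |w2| + |w3| \<le> 1\<close>. For real \<open>g1, g2, g3\<close> one has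
  \<open>|\<Sum> wj gj| \<le> \<Sum> cjk |gj - gk|\<close> with nonnegative \<open>cjk\<close> of total sum \<open>(|w1| + |w2| + |w3|) / 2\<close>.
  To apply this to functionals instead of numbers, without total variations or Riesz representation
  (the measures need not be regular), approximate \<open>f\<close> uniformly by \<open>\<Sum> z (\<psi> z \<circ> f)\<close>, where \<open>\<psi>\<close> is
  a finite partition of unity of the unit disc: a real functional \<open>l\<close> satisfies
  \<open>\<Sum> |l (\<psi> z \<circ> f)| \<le> \<parallel>l\<parallel>\<close>.
\<close>

subsection \<open>Integration against signed Borel measures\<close>

lemma sigma_algebra_borel_sets: "sigma_algebra (topspace X) (borel_sets X)"
  unfolding borel_sets_def by (intro sigma_algebra_sigma_sets) (auto dest: openin_subset)

lemma borel_sets_Diff: "A \<in> borel_sets X \<Longrightarrow> B \<in> borel_sets X \<Longrightarrow> A - B \<in> borel_sets X"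
  and borel_sets_Int: "A \<in> borel_sets X \<Longrightarrow> B \<in> borel_sets X \<Longrightarrow> A \<inter> B \<in> borel_sets X"
  and borel_sets_Un: "A \<in> borel_sets X \<Longrightarrow> B \<in> borel_sets X \<Longrightarrow> A \<union> B \<in> borel_sets X"
  and borel_sets_empty: "{} \<in> borel_sets X"
  and borel_sets_space: "topspace X \<in> borel_sets X"
proof -
  interpret sigma_algebra "topspace X" "borel_sets X" by (rule sigma_algebra_borel_sets)
  show "A \<in> borel_sets X \<Longrightarrow> B \<in> borel_sets X \<Longrightarrow> A - B \<in> borel_sets X"
    "A \<in> borel_sets X \<Longrightarrow> B \<in> borel_sets X \<Longrightarrow> A \<inter> B \<in> borel_sets X"
    "A \<in> borel_sets X \<Longrightarrow> B \<in> borel_sets X \<Longrightarrow> A \<union> B \<in> borel_sets X"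
    "{} \<in> borel_sets X" "topspace X \<in> borel_sets X"
    by auto
qed

lemma real_borel_measure_sums:
  assumes "real_borel_measure X \<mu>" "range A \<subseteq> borel_sets X" "disjoint_family A"
  shows "(\<lambda>i::nat. \<mu> (A i)) sums \<mu> (\<Union>i. A i)"
  using assms unfolding real_borel_measure_def by blast

lemma real_borel_measure_Un:
  assumes "real_borel_measure X \<mu>" "A \<in> borel_sets X" "B \<in> borel_sets X" "A \<inter> B = {}"
  shows "\<mu> (A \<union> B) = \<mu> A + \<mu> B"
proof -
  have "(\<lambda>n. \<mu> (binaryset A B n)) sums \<mu> (\<Union>i. binaryset A B i)"
    using assms by (intro real_borel_measure_sums)
      (auto simp: range_binaryset_eq borel_sets_empty disjoint_family_on_def binaryset_def)
  moreover have "(\<lambda>n. \<mu> (binaryset A B n)) sums (\<mu> A + \<mu> B)"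
    using assms(1) by (intro binaryset_sums) (auto simp: real_borel_measure_def)
  ultimately show ?thesis
    using sums_unique2 by (fastforce simp: UN_binaryset_eq)
qed

lemma real_borel_measure_Diff:
  assumes "real_borel_measure X \<mu>" "A \<in> borel_sets X" "B \<in> borel_sets X" "B \<subseteq> A"
  shows "\<mu> (A - B) = \<mu> A - \<mu> B"
  using real_borel_measure_Un[of X \<mu> B "A - B"] assms
  by (simp add: borel_sets_Diff Un_absorb1)

lemma real_borel_measure_minus: "real_borel_measure X \<mu> \<Longrightarrow> real_borel_measure X (- \<mu>)"
  by (auto simp: real_borel_measure_def intro: sums_minus)

lemma real_borel_measure_diff:
  "real_borel_measure X \<mu> \<Longrightarrow> real_borel_measure X \<nu> \<Longrightarrow> real_borel_measure X (\<mu> - \<nu>)"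
  by (auto simp: real_borel_measure_def intro: sums_diff)

text \<open>Finiteness of the supremum in \<open>pos_variation\<close> rests on this bound.\<close>

lemma real_borel_measure_bounded:
  assumes \<mu>: "real_borel_measure X \<mu>"
  obtains K where "\<And>B. B \<in> borel_sets X \<Longrightarrow> \<bar>\<mu> B\<bar> \<le> K"
proof -
  define unb where "unb E \<longleftrightarrow> E \<in> borel_sets X \<and>
    (\<forall>K. \<exists>B \<in> borel_sets X. B \<subseteq> E \<and> K < \<bar>\<mu> B\<bar>)" for E
  \<comment> \<open>If \<open>\<mu>\<close> is unbounded on \<open>E\<close>, a set \<open>B\<close> of large value splits \<open>E\<close> into two parts of value at least 1,
    and \<open>\<mu>\<close> is unbounded on one of them; the parts split off are disjoint, so their values are summable.\<close>
  have step: "\<exists>F. unb F \<and> F \<subseteq> E \<and> 1 \<le> \<bar>\<mu> (E - F)\<bar>" if E: "unb E" for E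
  proof -
    have Eb: "E \<in> borel_sets X" using E by (simp add: unb_def)
    obtain B where B: "B \<in> borel_sets X" "B \<subseteq> E" "\<bar>\<mu> E\<bar> + 1 < \<bar>\<mu> B\<bar>"
      using E unfolding unb_def by blast
    have d: "\<mu> (E - B) = \<mu> E - \<mu> B"
      using real_borel_measure_Diff \<mu> Eb B by blast
    have "unb B \<or> unb (E - B)"
    proof (rule ccontr)
      assume "\<not> (unb B \<or> unb (E - B))"
      then obtain K1 K2 where K: "\<And>C. C \<in> borel_sets X \<Longrightarrow> C \<subseteq> B \<Longrightarrow> \<bar>\<mu> C\<bar> \<le> K1"
        "\<And>C. C \<in> borel_sets X \<Longrightarrow> C \<subseteq> E - B \<Longrightarrow> \<bar>\<mu> C\<bar> \<le> K2"
        using B Eb by (force simp: unb_def not_less borel_sets_Diff)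
      have "\<bar>\<mu> C\<bar> \<le> K1 + K2" if C: "C \<in> borel_sets X" "C \<subseteq> E" for C
      proof -
        have "\<mu> ((C \<inter> B) \<union> (C - B)) = \<mu> (C \<inter> B) + \<mu> (C - B)"
          using \<mu> C B by (intro real_borel_measure_Un) (auto intro: borel_sets_Int borel_sets_Diff)
        then have "\<mu> C = \<mu> (C \<inter> B) + \<mu> (C - B)"
          by (simp add: Int_Diff_Un)
        moreover have "\<bar>\<mu> (C \<inter> B)\<bar> \<le> K1" "\<bar>\<mu> (C - B)\<bar> \<le> K2"
          using C B by (auto intro!: K borel_sets_Int borel_sets_Diff)
        ultimately show ?thesis by linarith
      qed
      then show False using E unfolding unb_def by (meson not_less)
    qed
    then show ?thesis
    proof
      assume "unb B"
      then show ?thesis using B d by (intro exI[of _ B]) auto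
    next
      assume "unb (E - B)"
      moreover have "E - (E - B) = B" using B by blast
      ultimately show ?thesis using B by (intro exI[of _ "E - B"]) auto
    qed
  qed
  have "\<not> unb (topspace X)"
  proof
    assume "unb (topspace X)"
    then obtain E where E: "\<And>n::nat. unb (E n)" "\<And>n. E (Suc n) \<subseteq> E n"
      "\<And>n. 1 \<le> \<bar>\<mu> (E n - E (Suc n))\<bar>"
      using dependent_nat_choice[of "\<lambda>_. unb" "\<lambda>_ E F. F \<subseteq> E \<and> 1 \<le> \<bar>\<mu> (E - F)\<bar>"] step by metis
    have "(E m - E (Suc m)) \<inter> (E n - E (Suc n)) = {}" if "m < n" for m n
      using lift_Suc_antimono_le[of E "Suc m" n] E(2) that by (simp add: Suc_le_eq) blast
    then have "disjoint_family (\<lambda>n. E n - E (Suc n))"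
      unfolding disjoint_family_on_def by (metis Int_commute linorder_neqE_nat)
    then have "(\<lambda>n. \<mu> (E n - E (Suc n))) sums \<mu> (\<Union>n. E n - E (Suc n))"
      using E(1) by (intro real_borel_measure_sums[OF \<mu>]) (auto simp: unb_def intro!: borel_sets_Diff)
    then have "(\<lambda>n. \<mu> (E n - E (Suc n))) \<longlonglongrightarrow> 0"
      using sums_summable summable_LIMSEQ_zero by blast
    then have "eventually (\<lambda>n. \<bar>\<mu> (E n - E (Suc n))\<bar> < 1) sequentially"
      using tendstoD[of "\<lambda>n. \<mu> (E n - E (Suc n))" 0 sequentially 1] by simp
    then show False using E(3) by (auto simp: eventually_sequentially not_less[symmetric])
  qed
  then obtain K where K: "\<And>B. B \<in> borel_sets X \<Longrightarrow> B \<subseteq> topspace X \<Longrightarrow> \<bar>\<mu> B\<bar> \<le> K"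
    unfolding unb_def by (meson borel_sets_space not_less)
  show thesis
  proof (rule that)
    show "\<bar>\<mu> B\<bar> \<le> K" if "B \<in> borel_sets X" for B
      using K that sigma_sets_into_sp[of "{U. openin X U}" "topspace X" B]
      by (auto simp: borel_sets_def dest: openin_subset)
  qed
qed

section \<open>Positive variation and the Jordan decomposition\<close>

lemma pos_variation_bdd_above:
  assumes "real_borel_measure X \<mu>"
  shows "bdd_above (\<mu> ` {B \<in> borel_sets X. B \<subseteq> A})"
proof -
  obtain K where "\<And>B. B \<in> borel_sets X \<Longrightarrow> \<bar>\<mu> B\<bar> \<le> K"
    using real_borel_measure_bounded assms by blast
  then show ?thesis by (intro bdd_aboveI[of _ K]) (auto dest: abs_le_D1)
qed

lemma le_pos_variation:
  assumes "real_borel_measure X \<mu>" "B \<in> borel_sets X" "B \<subseteq> A"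
  shows "\<mu> B \<le> pos_variation X \<mu> A"
  unfolding pos_variation_def using assms by (intro cSUP_upper pos_variation_bdd_above) auto

lemma pos_variation_le:
  assumes "\<And>B. B \<in> borel_sets X \<Longrightarrow> B \<subseteq> A \<Longrightarrow> \<mu> B \<le> c"
  shows "pos_variation X \<mu> A \<le> c"
  unfolding pos_variation_def using assms borel_sets_empty by (intro cSUP_least) auto

lemma pos_variation_nonneg: "real_borel_measure X \<mu> \<Longrightarrow> 0 \<le> pos_variation X \<mu> A"
  using le_pos_variation[of X \<mu> "{}" A] borel_sets_empty[of X] by (simp add: real_borel_measure_def)

lemma pos_variation_mono:
  "real_borel_measure X \<mu> \<Longrightarrow> A \<subseteq> A' \<Longrightarrow> pos_variation X \<mu> A \<le> pos_variation X \<mu> A'"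
  by (rule pos_variation_le) (auto intro: le_pos_variation)

text \<open>Borel subsets of \<open>A\<close> and of \<open>A'\<close> unite to a competitor for
  \<open>A \<union> A'\<close>; the two suprema are taken one after the other.\<close>

lemma pos_variation_Un_ge:
  assumes \<mu>: "real_borel_measure X \<mu>" and "A \<inter> A' = {}"
  shows "pos_variation X \<mu> A + pos_variation X \<mu> A' \<le> pos_variation X \<mu> (A \<union> A')"
proof -
  have "pos_variation X \<mu> A \<le> pos_variation X \<mu> (A \<union> A') - pos_variation X \<mu> A'"
  proof (rule pos_variation_le)
    fix B assume B: "B \<in> borel_sets X" "B \<subseteq> A"
    have "pos_variation X \<mu> A' \<le> pos_variation X \<mu> (A \<union> A') - \<mu> B"
    proof (rule pos_variation_le)
      fix B' assume B': "B' \<in> borel_sets X" "B' \<subseteq> A'"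
      have "\<mu> (B \<union> B') = \<mu> B + \<mu> B'"
        using B B' assms by (intro real_borel_measure_Un) auto
      moreover have "\<mu> (B \<union> B') \<le> pos_variation X \<mu> (A \<union> A')"
        using B B' \<mu> by (intro le_pos_variation borel_sets_Un) auto
      ultimately show "\<mu> B' \<le> pos_variation X \<mu> (A \<union> A') - \<mu> B" by simp
    qed
    then show "\<mu> B \<le> pos_variation X \<mu> (A \<union> A') - pos_variation X \<mu> A'" by simp
  qed
  then show ?thesis by simp
qed

text \<open>One direction comes from superadditivity over finite unions and monotonicity, the other
  from cutting a Borel subset \<open>B\<close> of the union into the pieces
  \<open>B \<inter> A i\<close>.\<close>

lemma pos_variation_sums:
  assumes \<mu>: "real_borel_measure X \<mu>" and A: "range A \<subseteq> borel_sets X" "disjoint_family A"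
  shows "(\<lambda>i::nat. pos_variation X \<mu> (A i)) sums pos_variation X \<mu> (\<Union>i. A i)"
proof -
  let ?p = "pos_variation X \<mu>"
  have part: "(\<Sum>i<n. ?p (A i)) \<le> ?p (\<Union>i<n. A i)" for n
  proof (induction n)
    case 0
    then show ?case using pos_variation_nonneg[OF \<mu>] by simp
  next
    case (Suc n)
    have "?p (\<Union>i<n. A i) + ?p (A n) \<le> ?p ((\<Union>i<n. A i) \<union> A n)"
    proof (rule pos_variation_Un_ge[OF \<mu>])
      have "A i \<inter> A n = {}" if "i < n" for i
        using A(2) that by (simp add: disjoint_family_on_def)
      then show "(\<Union>i<n. A i) \<inter> A n = {}" by blast
    qed
    then show ?case using Suc by (simp add: lessThan_Suc Un_commute)
  qed
  have le: "(\<Sum>i<n. ?p (A i)) \<le> ?p (\<Union>i. A i)" for n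
    using part[of n] pos_variation_mono[OF \<mu>, of "\<Union>i<n. A i" "\<Union>i. A i"] by fastforce
  have sm: "summable (\<lambda>i. ?p (A i))"
    using pos_variation_nonneg[OF \<mu>] le by (rule summableI_nonneg_bounded)
  moreover have "(\<Sum>i. ?p (A i)) \<le> ?p (\<Union>i. A i)"
    using sm le by (intro suminf_le_const)
  moreover have "?p (\<Union>i. A i) \<le> (\<Sum>i. ?p (A i))"
  proof (rule pos_variation_le)
    fix B assume B: "B \<in> borel_sets X" "B \<subseteq> (\<Union>i. A i)"
    have "(\<lambda>i. \<mu> (B \<inter> A i)) sums \<mu> (\<Union>i. B \<inter> A i)"
      using A B by (intro real_borel_measure_sums[OF \<mu>])
        (auto simp: disjoint_family_on_def intro!: borel_sets_Int)
    moreover have "(\<Union>i. B \<inter> A i) = B" using B by blast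
    ultimately have sB: "(\<lambda>i. \<mu> (B \<inter> A i)) sums \<mu> B" by simp
    have "\<mu> (B \<inter> A i) \<le> ?p (A i)" for i
      using A B by (intro le_pos_variation \<mu> borel_sets_Int) auto
    then show "\<mu> B \<le> (\<Sum>i. ?p (A i))"
      by (rule sums_le[OF _ sB summable_sums[OF sm]])
  qed
  ultimately show ?thesis by (auto simp: sums_iff)
qed

text \<open>Jordan decomposition without a Hahn set: since
  \<open>\<mu> B = \<mu> A + (- \<mu>) (A - B)\<close>, passing from \<open>B\<close> to
  \<open>A - B\<close> gives one inequality between the suprema, and the same for
  \<open>- \<mu>\<close> gives the other.\<close>

lemma pos_variation_uminus:
  assumes \<mu>: "real_borel_measure X \<mu>" and A: "A \<in> borel_sets X"
  shows "pos_variation X \<mu> A - pos_variation X (- \<mu>) A = \<mu> A"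
proof -
  have le: "pos_variation X \<nu> A \<le> pos_variation X (- \<nu>) A + \<nu> A" if \<nu>: "real_borel_measure X \<nu>" for \<nu>
  proof (rule pos_variation_le)
    fix B assume B: "B \<in> borel_sets X" "B \<subseteq> A"
    have "\<nu> (A - B) = \<nu> A - \<nu> B" using real_borel_measure_Diff \<nu> A B by blast
    moreover have "(- \<nu>) (A - B) \<le> pos_variation X (- \<nu>) A"
      using A B by (intro le_pos_variation real_borel_measure_minus \<nu> borel_sets_Diff) auto
    ultimately show "\<nu> B \<le> pos_variation X (- \<nu>) A + \<nu> A" by simp
  qed
  have "- (- \<mu>) = \<mu>" by (simp add: fun_eq_iff)
  then show ?thesis
    using le[OF \<mu>] le[OF real_borel_measure_minus[OF \<mu>]] by simp
qed

section \<open>The positive part as a finite measure\<close>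

lemma space_pos_part_measure [simp]: "space (pos_part_measure X \<mu>) = topspace X"
  unfolding pos_part_measure_def by (intro space_measure_of) (auto dest: openin_subset)

lemma sets_pos_part_measure [simp]: "sets (pos_part_measure X \<mu>) = borel_sets X"
  unfolding pos_part_measure_def borel_sets_def by (intro sets_measure_of) (auto dest: openin_subset)

lemma emeasure_pos_part_measure:
  assumes \<mu>: "real_borel_measure X \<mu>" and A: "A \<in> borel_sets X"
  shows "emeasure (pos_part_measure X \<mu>) A = ennreal (pos_variation X \<mu> A)"
proof (rule emeasure_measure_of[OF pos_part_measure_def])
  \<comment> \<open>\<open>ennreal\<close> sends nonpositive reals to 0, so this upper bound settles
    the value at the empty set.\<close>
  have "pos_variation X \<mu> {} \<le> 0"
    using \<mu> by (intro pos_variation_le) (auto simp: real_borel_measure_def)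
  then show "positive (sets (pos_part_measure X \<mu>)) (\<lambda>A. ennreal (pos_variation X \<mu> A))"
    by (simp add: positive_def ennreal_neg)
  show "countably_additive (sets (pos_part_measure X \<mu>)) (\<lambda>A. ennreal (pos_variation X \<mu> A))"
  proof (rule countably_additiveI)
    fix A :: "nat \<Rightarrow> 'a set"
    assume "range A \<subseteq> sets (pos_part_measure X \<mu>)" "disjoint_family A"
    then show "(\<Sum>i. ennreal (pos_variation X \<mu> (A i))) = ennreal (pos_variation X \<mu> (\<Union>i. A i))"
      by (intro suminf_ennreal_eq pos_variation_nonneg[OF \<mu>] pos_variation_sums[OF \<mu>]) simp_all
  qed
qed (use A in \<open>auto dest: openin_subset\<close>)

lemma measure_pos_part_measure:
  assumes "real_borel_measure X \<mu>" "A \<in> borel_sets X"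
  shows "measure (pos_part_measure X \<mu>) A = pos_variation X \<mu> A"
  using assms by (simp add: measure_def emeasure_pos_part_measure pos_variation_nonneg)

lemma finite_measure_pos_part_measure:
  "real_borel_measure X \<mu> \<Longrightarrow> finite_measure (pos_part_measure X \<mu>)"
  by (intro finite_measureI) (simp add: emeasure_pos_part_measure borel_sets_space)

section \<open>Integrals of bounded continuous functions\<close>

lemma borel_measurable_pos_part_measure:
  assumes "continuous_map X euclidean f"
  shows "f \<in> borel_measurable (pos_part_measure X \<mu>)"
proof (rule borel_measurableI)
  fix S :: "'b set" assume "open S"
  then have "openin X {x \<in> topspace X. f x \<in> S}"
    using assms by (simp add: continuous_map_def)
  moreover have "f -` S \<inter> topspace X = {x \<in> topspace X. f x \<in> S}" by blast
  ultimately show "f -` S \<inter> space (pos_part_measure X \<mu>) \<in> sets (pos_part_measure X \<mu>)"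
    by (simp add: borel_sets_def sigma_sets.Basic)
qed

lemma integrable_pos_part_measure:
  fixes f :: "'a \<Rightarrow> complex"
  assumes "real_borel_measure X \<mu>" and f: "continuous_map X euclidean f"
    and "\<And>x. x \<in> topspace X \<Longrightarrow> cmod (f x) \<le> B"
  shows "integrable (pos_part_measure X \<mu>) f"
proof -
  interpret finite_measure "pos_part_measure X \<mu>" by (rule finite_measure_pos_part_measure) fact
  show ?thesis
    using assms by (intro integrable_const_bound[where B=B] borel_measurable_pos_part_measure) auto
qed

text \<open>The positive variation is not additive in \<open>\<mu>\<close>, but on each level set
  the two variations differ by \<open>\<mu>\<close> itself, so the formula is visibly linear in
  \<open>\<mu>\<close>. Being simple depends only on the sigma-algebra, hence the unrelated
  \<open>\<nu>\<close>.\<close>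

lemma signed_integral_simple:
  assumes \<mu>: "real_borel_measure X \<mu>" and s: "simple_function (pos_part_measure X \<nu>) s"
  shows "signed_integral X \<mu> s = (\<Sum>y\<in>s ` topspace X. \<mu> {x \<in> topspace X. s x = y} *\<^sub>R y)"
proof -
  have lev: "{x \<in> topspace X. s x = y} \<in> borel_sets X" for y
    using simple_functionD(2)[OF s, of "{y}"] by (auto simp: vimage_def Int_def conj_commute)
  have I: "integral\<^sup>L (pos_part_measure X \<rho>) s =
      (\<Sum>y\<in>s ` topspace X. pos_variation X \<rho> {x \<in> topspace X. s x = y} *\<^sub>R y)"
    if \<rho>: "real_borel_measure X \<rho>" for \<rho>
  proof -
    interpret finite_measure "pos_part_measure X \<rho>" by (rule finite_measure_pos_part_measure) fact
    have "simple_function (pos_part_measure X \<rho>) s"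
      using s simple_function_cong_algebra[of "pos_part_measure X \<rho>" "pos_part_measure X \<nu>" s] by simp
    then have "Bochner_Integration.simple_bochner_integrable (pos_part_measure X \<rho>) s"
      by (rule simple_bochner_integrable.intros) simp
    then show ?thesis
      by (simp add: simple_bochner_integral_def measure_pos_part_measure \<rho> lev
        flip: simple_bochner_integrable_eq_integral)
  qed
  show ?thesis
    unfolding signed_integral_def I[OF \<mu>] I[OF real_borel_measure_minus[OF \<mu>]]
    by (simp add: lev pos_variation_uminus[OF \<mu>] flip: sum_subtractf scaleR_diff_left)
qed

text \<open>Linearity in the measure is clear for simple functions and passes to \<open>f\<close> by
  dominated convergence; the dominating constant is integrable because the measures are
  finite.\<close>

lemma signed_integral_measure_diff:
  assumes \<mu>: "real_borel_measure X \<mu>" and \<nu>: "real_borel_measure X \<nu>"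
    and f: "continuous_map X euclidean f" and B: "\<And>x. x \<in> topspace X \<Longrightarrow> cmod (f x) \<le> B"
  shows "signed_integral X (\<mu> - \<nu>) f = signed_integral X \<mu> f - signed_integral X \<nu> f"
proof -
  \<comment> \<open>The base point 0 turns the distance bound of the approximation theorem into a
    bound by \<open>2 * cmod (f x)\<close>.\<close>
  obtain s where s: "\<And>i::nat. simple_function (pos_part_measure X \<mu>) (s i)"
    "\<And>x. x \<in> topspace X \<Longrightarrow> (\<lambda>i. s i x) \<longlonglongrightarrow> f x"
    "\<And>i x. x \<in> topspace X \<Longrightarrow> cmod (s i x) \<le> 2 * cmod (f x)"
    using borel_measurable_implies_sequence_metric[OF borel_measurable_pos_part_measure[OF f, of \<mu>], of 0]
    by (simp add: Ball_def) metis
  have I: "(\<lambda>i. integral\<^sup>L (pos_part_measure X \<rho>) (s i)) \<longlonglongrightarrow> integral\<^sup>L (pos_part_measure X \<rho>) f"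
    if \<rho>: "real_borel_measure X \<rho>" for \<rho>
  proof (rule integral_dominated_convergence)
    show "f \<in> borel_measurable (pos_part_measure X \<rho>)"
      by (rule borel_measurable_pos_part_measure) fact
    show "s i \<in> borel_measurable (pos_part_measure X \<rho>)" for i
      using s(1)[of i] simple_function_cong_algebra[of "pos_part_measure X \<rho>" "pos_part_measure X \<mu>" "s i"]
      by (intro borel_measurable_simple_function) simp
    show "integrable (pos_part_measure X \<rho>) (\<lambda>_. 2 * B)"
      using finite_measure_pos_part_measure[OF \<rho>] by (simp add: finite_measure.integrable_const)
    show "AE x in pos_part_measure X \<rho>. (\<lambda>i. s i x) \<longlonglongrightarrow> f x"
      by (rule AE_I2) (simp add: s(2))
    show "AE x in pos_part_measure X \<rho>. cmod (s i x) \<le> 2 * B" for i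
      using s(3)[of _ i] B by (intro AE_I2) (fastforce intro: order_trans)
  qed
  have S: "(\<lambda>i. signed_integral X \<rho> (s i)) \<longlonglongrightarrow> signed_integral X \<rho> f"
    if \<rho>: "real_borel_measure X \<rho>" for \<rho>
    unfolding signed_integral_def
    by (intro tendsto_diff I \<rho> real_borel_measure_minus)
  have "signed_integral X (\<mu> - \<nu>) (s i) = signed_integral X \<mu> (s i) - signed_integral X \<nu> (s i)" for i
    using signed_integral_simple[OF _ s(1)[of i]] \<mu> \<nu> real_borel_measure_diff[OF \<mu> \<nu>]
    by (simp add: scaleR_diff_left sum_subtractf)
  then have "(\<lambda>i. signed_integral X (\<mu> - \<nu>) (s i)) \<longlonglongrightarrow> signed_integral X \<mu> f - signed_integral X \<nu> f"
    using tendsto_diff[OF S[OF \<mu>] S[OF \<nu>]] by simp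
  then show ?thesis
    using S[OF real_borel_measure_diff[OF \<mu> \<nu>]] LIMSEQ_unique by blast
qed

text \<open>The constant is the total mass of the two Jordan parts. It serves to bound suprema and
  to control errors that tend to 0.\<close>

lemma signed_integral_bounded:
  assumes \<mu>: "real_borel_measure X \<mu>"
  obtains K where "0 \<le> K" and "\<And>f B. continuous_map X euclidean f \<Longrightarrow>
    (\<And>x. x \<in> topspace X \<Longrightarrow> cmod (f x) \<le> B) \<Longrightarrow> cmod (signed_integral X \<mu> f) \<le> K * B"
proof -
  define m where "m \<rho> = measure (pos_part_measure X \<rho>) (topspace X)" for \<rho>
  have I: "cmod (integral\<^sup>L (pos_part_measure X \<rho>) f) \<le> m \<rho> * B"
    if \<rho>: "real_borel_measure X \<rho>" and f: "continuous_map X euclidean f"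
      and B: "\<And>x. x \<in> topspace X \<Longrightarrow> cmod (f x) \<le> B" for \<rho> f B
  proof -
    interpret finite_measure "pos_part_measure X \<rho>" by (rule finite_measure_pos_part_measure) fact
    have "cmod (integral\<^sup>L (pos_part_measure X \<rho>) f) \<le> (\<integral>x. cmod (f x) \<partial>pos_part_measure X \<rho>)"
      by (rule integral_norm_bound)
    also have "\<dots> \<le> (\<integral>x. B \<partial>pos_part_measure X \<rho>)"
      using B by (intro integral_mono integrable_norm integrable_pos_part_measure[OF \<rho> f]) auto
    finally show ?thesis by (simp add: m_def)
  qed
  show thesis
  proof
    show "0 \<le> m \<mu> + m (- \<mu>)" by (simp add: m_def)
    show "cmod (signed_integral X \<mu> f) \<le> (m \<mu> + m (- \<mu>)) * B"
      if "continuous_map X euclidean f" "\<And>x. x \<in> topspace X \<Longrightarrow> cmod (f x) \<le> B" for f B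
      using norm_triangle_le_diff[OF add_mono[OF I[OF \<mu> that] I[OF real_borel_measure_minus[OF \<mu>] that]]]
      by (simp add: signed_integral_def distrib_right)
  qed
qed

lemma signed_integral_sum:
  assumes \<mu>: "real_borel_measure X \<mu>" and "\<And>i. i \<in> I \<Longrightarrow> continuous_map X euclidean (f i)"
    and "\<And>i x. i \<in> I \<Longrightarrow> x \<in> topspace X \<Longrightarrow> cmod (f i x) \<le> B"
  shows "signed_integral X \<mu> (\<lambda>x. \<Sum>i\<in>I. c i * f i x) = (\<Sum>i\<in>I. c i * signed_integral X \<mu> (f i))"
proof -
  have I: "integral\<^sup>L (pos_part_measure X \<rho>) (\<lambda>x. \<Sum>i\<in>I. c i * f i x)
      = (\<Sum>i\<in>I. c i * integral\<^sup>L (pos_part_measure X \<rho>) (f i))"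
    if \<rho>: "real_borel_measure X \<rho>" for \<rho>
  proof -
    have "integrable (pos_part_measure X \<rho>) (f i)" if "i \<in> I" for i
      by (rule integrable_pos_part_measure[OF \<rho> assms(2)[OF that] assms(3)[OF that]])
    then show ?thesis by simp
  qed
  show ?thesis
    unfolding signed_integral_def I[OF \<mu>] I[OF real_borel_measure_minus[OF \<mu>]]
    by (simp add: sum_subtractf right_diff_distrib)
qed

lemma signed_integral_diff:
  assumes \<mu>: "real_borel_measure X \<mu>"
    and f: "continuous_map X euclidean f" "\<And>x. x \<in> topspace X \<Longrightarrow> cmod (f x) \<le> B"
    and g: "continuous_map X euclidean g" "\<And>x. x \<in> topspace X \<Longrightarrow> cmod (g x) \<le> B'"
  shows "signed_integral X \<mu> (\<lambda>x. f x - g x) = signed_integral X \<mu> f - signed_integral X \<mu> g"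
  unfolding signed_integral_def
  using integrable_pos_part_measure[OF \<mu> f] integrable_pos_part_measure[OF \<mu> g]
    integrable_pos_part_measure[OF real_borel_measure_minus[OF \<mu>] f]
    integrable_pos_part_measure[OF real_borel_measure_minus[OF \<mu>] g]
  by simp

lemma signed_integral_of_real:
  "signed_integral X \<mu> (\<lambda>x. complex_of_real (g x)) \<in> \<real>"
  by (simp add: signed_integral_def)

subsection \<open>Plane geometry\<close>

text \<open>The weights \<open>t\<close> maximising the variance \<open>D\<close> of \<open>v\<close> over the simplex have as their mean the centre
  \<open>z\<close> of the smallest enclosing disc, and \<open>D t\<close> is its squared radius: moving \<open>t\<close> slightly towards a
  vertex \<open>j\<close> cannot increase \<open>D\<close>, which gives \<open>|v j - z|\<^sup>2 \<le> D t\<close>.\<close>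

lemma enclosing_disc_dual:
  fixes v :: "'n::finite \<Rightarrow> complex"
  obtains z w where "(\<Sum>j\<in>UNIV. w j) = 0" and "(\<Sum>j\<in>UNIV. cmod (w j)) \<le> 1"
    and "\<And>j. cmod (v j - z) \<le> cmod (\<Sum>j\<in>UNIV. w j * v j)"
proof -
  define S where "S = {t :: real ^ 'n. (\<forall>j. 0 \<le> t $ j) \<and> (\<Sum>j\<in>UNIV. t $ j) = 1}"
  define mean where "mean t = (\<Sum>j\<in>UNIV. t $ j *\<^sub>R v j)" for t :: "real ^ 'n"
  define D where "D t = (\<Sum>j\<in>UNIV. t $ j * (cmod (v j))\<^sup>2) - (cmod (mean t))\<^sup>2" for t :: "real ^ 'n"
  have le1: "t $ j \<le> 1" if "t \<in> S" for t j
    using that member_le_sum[of j UNIV "\<lambda>j. t $ j"] by (auto simp: S_def)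
  have "closed S"
    unfolding S_def by (intro closed_Collect_conj closed_Collect_all closed_Collect_le closed_Collect_eq continuous_intros)
  moreover have "S \<subseteq> cbox 0 (\<chi> j. 1)"
    using le1 by (auto simp: S_def mem_box_cart)
  ultimately have "compact S"
    using compact_cbox closed_Int_compact by (metis inf.absorb1)
  \<comment> \<open>Any vertex shows that the simplex is nonempty.\<close>
  moreover have "axis undefined 1 \<in> S"
    by (auto simp: S_def axis_def)
  moreover have "continuous_on S D"
    unfolding D_def mean_def by (intro continuous_intros)
  ultimately obtain t where t: "t \<in> S" and max: "\<And>u. u \<in> S \<Longrightarrow> D u \<le> D t"
    using continuous_attains_sup[of S D] by blast
  define z where "z = mean t"
  have t0: "\<And>j. 0 \<le> t $ j" and t1: "(\<Sum>j\<in>UNIV. t $ j) = 1"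
    using t by (auto simp: S_def)
  have centred: "(\<Sum>j\<in>UNIV. t $ j *\<^sub>R (v j - z)) = 0"
    using t1 by (simp add: scaleR_diff_right sum_subtractf z_def mean_def flip: scaleR_left.sum)
  \<comment> \<open>The second form of a variance, by expanding the square; the cross terms add up
    to \<open>2 * (z \<bullet> z)\<close> because \<open>z\<close> is the mean.\<close>
  have D_z: "D t = (\<Sum>j\<in>UNIV. t $ j * (cmod (v j - z))\<^sup>2)"
  proof -
    have "(\<Sum>j\<in>UNIV. t $ j * (cmod (v j - z))\<^sup>2) =
      (\<Sum>j\<in>UNIV. t $ j * (cmod (v j))\<^sup>2 + t $ j * (cmod z)\<^sup>2 - 2 * (z \<bullet> (t $ j *\<^sub>R v j)))"
      by (intro sum.cong refl) (simp add: power2_norm_eq_inner algebra_simps inner_commute)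
    also have "\<dots> = (\<Sum>j\<in>UNIV. t $ j * (cmod (v j))\<^sup>2) + (cmod z)\<^sup>2 - 2 * (z \<bullet> z)"
      using t1 by (simp add: sum.distrib sum_subtractf z_def mean_def inner_sum_right
        flip: sum_distrib_left sum_distrib_right)
    finally show ?thesis
      by (simp add: D_def z_def power2_norm_eq_inner)
  qed
  have near: "(cmod (v j - z))\<^sup>2 \<le> D t" for j
  proof -
    \<comment> \<open>The point \<open>u\<close> below moves \<open>t\<close> towards the vertex
      \<open>j\<close>. It has
      \<open>D u = (1 - s) * D t + s * (1 - s) * (cmod (v j - z))\<^sup>2\<close>; comparing with
      \<open>D u \<le> D t\<close> and cancelling \<open>s\<close> gives the claim.\<close>
    have mix: "(1 - s) * (cmod (v j - z))\<^sup>2 \<le> D t" if s: "0 < s" "s < 1" for s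
    proof -
      define u where "u = (1 - s) *\<^sub>R t + s *\<^sub>R axis j 1"
      have sm: "(\<Sum>i\<in>UNIV. axis j (1::real) $ i *\<^sub>R F i) = F j" for F :: "'n \<Rightarrow> 'b::real_vector"
        by (simp add: axis_def if_distrib[of "\<lambda>c. c *\<^sub>R _"] cong: if_cong)
      have sm': "(\<Sum>i\<in>UNIV. axis j (1::real) $ i * F i) = F j" for F :: "'n \<Rightarrow> real"
        using sm[of F] by simp
      have "u \<in> S"
        using s t0 t1 sm'[of "\<lambda>_. 1"]
        by (auto simp: S_def u_def sum.distrib axis_def simp flip: sum_distrib_left)
      then have "D u \<le> D t" by (rule max)
      have mu: "mean u = z + s *\<^sub>R (v j - z)"
      proof -
        have "mean u = (1 - s) *\<^sub>R mean t + s *\<^sub>R v j"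
          by (simp add: mean_def u_def scaleR_add_left sum.distrib sm
            flip: scaleR_scaleR scaleR_right.sum)
        then show ?thesis by (simp add: z_def algebra_simps)
      qed
      have "D u = (1 - s) * (\<Sum>j\<in>UNIV. t $ j * (cmod (v j))\<^sup>2) + s * (cmod (v j))\<^sup>2 - (cmod (mean u))\<^sup>2"
        by (simp add: D_def u_def distrib_right sum.distrib sm' mult.assoc flip: sum_distrib_left)
      also have "\<dots> = (1 - s) * (D t + (cmod z)\<^sup>2) + s * (cmod (v j))\<^sup>2 - (cmod (z + s *\<^sub>R (v j - z)))\<^sup>2"
        by (simp add: mu) (simp add: D_def z_def)
      also have "\<dots> = (1 - s) * D t + s * (1 - s) * (cmod (v j - z))\<^sup>2"
        unfolding power2_norm_eq_inner by (simp add: inner_commute algebra_simps power2_eq_square)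
      finally have "s * ((1 - s) * (cmod (v j - z))\<^sup>2) \<le> s * D t"
        using \<open>D u \<le> D t\<close> by (simp add: algebra_simps)
      then show ?thesis using s by simp
    qed
    have "((\<lambda>s. (1 - s) * (cmod (v j - z))\<^sup>2) \<longlongrightarrow> (1 - 0) * (cmod (v j - z))\<^sup>2) (at_right 0)"
      by (intro tendsto_intros)
    moreover have "eventually (\<lambda>s::real. (1 - s) * (cmod (v j - z))\<^sup>2 \<le> D t) (at_right 0)"
      using eventually_at_right_less[of 0]
      by (auto simp: eventually_at_right_field intro!: exI[of _ 1] mix)
    ultimately show ?thesis
      using tendsto_upperbound by fastforce
  qed
  define R where "R = sqrt (D t)"
  have D0: "0 \<le> D t" using near by (meson order_trans zero_le_power2)
  have nearR: "cmod (v j - z) \<le> R" for j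
    using near[of j] by (simp add: R_def real_le_rsqrt)
  \<comment> \<open>The conjugate makes
    \<open>w j * (v j - z) = t $ j * (cmod (v j - z))\<^sup>2 / R\<close>, with sum
    \<open>D t / R = R\<close>; the weights sum to 0 because \<open>z\<close> is the mean. If
    \<open>R = 0\<close>, all \<open>v j\<close> equal \<open>z\<close> and division by 0 makes the
    weights 0.\<close>
  define w where "w j = t $ j *\<^sub>R (cnj (v j - z) / R)" for j
  have sw: "(\<Sum>j\<in>UNIV. w j) = 0"
  proof -
    have "(\<Sum>j\<in>UNIV. w j) = cnj (\<Sum>j\<in>UNIV. t $ j *\<^sub>R (v j - z)) / R"
      by (simp add: w_def scaleR_conv_of_real sum_divide_distrib)
    then show ?thesis unfolding centred by simp
  qed
  show thesis
  proof
    show "(\<Sum>j\<in>UNIV. w j) = 0" by fact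
    have "(\<Sum>j\<in>UNIV. cmod (w j)) \<le> (\<Sum>j\<in>UNIV. t $ j)"
    proof (rule sum_mono)
      fix j
      have "cmod (v j - z) / R \<le> 1"
        using nearR[of j] by (simp add: divide_le_eq_1) (metis norm_le_zero_iff not_less_iff_gr_or_eq order_less_le_trans norm_ge_zero)
      moreover have "cmod (w j) = t $ j * (cmod (v j - z) / R)"
        using t0[of j] D0 by (simp add: w_def norm_divide R_def flip: complex_cnj_diff)
      ultimately show "cmod (w j) \<le> t $ j"
        using t0[of j] by (metis mult_left_le)
    qed
    then show "(\<Sum>j\<in>UNIV. cmod (w j)) \<le> 1" using t1 by simp
    have "(\<Sum>j\<in>UNIV. w j * v j) = (\<Sum>j\<in>UNIV. w j * (v j - z))"
      using sw by (simp add: right_diff_distrib sum_subtractf flip: sum_distrib_right)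
    also have "\<dots> = of_real ((\<Sum>j\<in>UNIV. t $ j * (cmod (v j - z))\<^sup>2) / R)"
      by (simp add: w_def scaleR_conv_of_real sum_divide_distrib complex_norm_square
        mult_ac flip: complex_cnj_diff del: of_real_power)
    also have "\<dots> = of_real R"
      using D0 by (simp add: R_def real_div_sqrt flip: D_z)
    finally show "cmod (v j - z) \<le> cmod (\<Sum>j\<in>UNIV. w j * v j)" for j
      using nearR[of j] D0 by (simp add: R_def)
  qed
qed

text \<open>The weights on the right-hand side come from writing the triple of lengths
  \<open>|w1|, |w2|, |w3|\<close> as a sum over the three pairs; the reals \<open>g1, g2, g3\<close> are then
  decomposed into indicators of up-sets, for each of which both sides are equal.\<close>

lemma cut_inequality_ordered:
  fixes w1 w2 w3 :: complex and g1 g2 g3 :: real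
  assumes "w1 + w2 + w3 = 0" "g1 \<le> g2" "g2 \<le> g3"
  shows "2 * cmod (w1 * g1 + w2 * g2 + w3 * g3) \<le>
    (cmod w1 + cmod w2 - cmod w3) * \<bar>g1 - g2\<bar> + (cmod w1 + cmod w3 - cmod w2) * \<bar>g1 - g3\<bar>
      + (cmod w2 + cmod w3 - cmod w1) * \<bar>g2 - g3\<bar>"
proof -
  \<comment> \<open>Since \<open>w2 = - w1 - w3\<close>, only the gaps between the ordered reals
    remain. On the right of the claim \<open>g2 - g1\<close> has total coefficient
    \<open>2 * cmod w1\<close> and \<open>g3 - g2\<close> has \<open>2 * cmod w3\<close>.\<close>
  have "w1 * g1 + w2 * g2 + w3 * g3 = w3 * of_real (g3 - g2) - w1 * of_real (g2 - g1)"
    using assms(1) by (simp add: algebra_simps eq_neg_iff_add_eq_0) algebra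
  then have "cmod (w1 * g1 + w2 * g2 + w3 * g3) \<le> cmod w3 * (g3 - g2) + cmod w1 * (g2 - g1)"
    using norm_triangle_ineq4[of "w3 * of_real (g3 - g2)" "w1 * of_real (g2 - g1)"] assms
    by (simp add: norm_mult del: of_real_diff)
  then show ?thesis using assms by (simp add: algebra_simps)
qed

text \<open>The claim is invariant under simultaneous permutations of weights and reals, so the
  reals may be sorted.\<close>

lemma cut_inequality:
  fixes w1 w2 w3 :: complex and g1 g2 g3 :: real
  assumes "w1 + w2 + w3 = 0"
  shows "2 * cmod (w1 * g1 + w2 * g2 + w3 * g3) \<le>
    (cmod w1 + cmod w2 - cmod w3) * \<bar>g1 - g2\<bar> + (cmod w1 + cmod w3 - cmod w2) * \<bar>g1 - g3\<bar>
      + (cmod w2 + cmod w3 - cmod w1) * \<bar>g2 - g3\<bar>"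
proof -
  consider "g1 \<le> g2" "g2 \<le> g3" | "g1 \<le> g3" "g3 \<le> g2" | "g2 \<le> g1" "g1 \<le> g3"
    | "g2 \<le> g3" "g3 \<le> g1" | "g3 \<le> g1" "g1 \<le> g2" | "g3 \<le> g2" "g2 \<le> g1" by linarith
  then show ?thesis
    using assms cut_inequality_ordered[of w1 w2 w3 g1 g2 g3] cut_inequality_ordered[of w1 w3 w2 g1 g3 g2]
      cut_inequality_ordered[of w2 w1 w3 g2 g1 g3] cut_inequality_ordered[of w2 w3 w1 g2 g3 g1]
      cut_inequality_ordered[of w3 w1 w2 g3 g1 g2] cut_inequality_ordered[of w3 w2 w1 g3 g2 g1]
    by cases (simp_all add: ac_simps abs_minus_commute)
qed

subsection \<open>Operator norms\<close>

text \<open>The sides of a closed triangle; this makes the coefficients in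
  \<open>cut_inequality\<close> nonnegative.\<close>

lemma cmod_le_add_of_sum_zero:
  fixes a b c :: complex
  assumes "a + b + c = 0"
  shows "cmod a \<le> cmod b + cmod c"
proof -
  have "a = - (b + c)" using assms by (simp only: eq_neg_iff_add_eq_0 add.assoc)
  then show ?thesis by (metis norm_minus_cancel norm_triangle_ineq)
qed

section \<open>Partitions of unity and norms of functionals\<close>

lemma continuous_map_mult_of_real:
  assumes "continuous_map X euclideanreal \<phi>"
  shows "continuous_map X euclidean (\<lambda>x. c * complex_of_real (\<phi> x))"
  using assms by (simp add: continuous_map_atin tendsto_intros)

text \<open>Hat functions of radius \<open>e\<close> around a finite \<open>e\<close>-net of the
  disc are divided by their sum, which is positive on the disc. At \<open>x\<close> only net points
  closer than \<open>e\<close> have nonzero weight, so their weighted mean is within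
  \<open>e\<close> of \<open>x\<close>.\<close>

lemma disc_partition_of_unity:
  fixes e :: real
  assumes e: "0 < e"
  obtains Z :: "complex set" and \<psi> :: "complex \<Rightarrow> complex \<Rightarrow> real"
  where "finite Z" and "\<And>z. z \<in> Z \<Longrightarrow> cmod z \<le> 1"
    and "\<And>z. continuous_on (cball 0 1) (\<psi> z)" and "\<And>z x. 0 \<le> \<psi> z x"
    and "\<And>x. cmod x \<le> 1 \<Longrightarrow> (\<Sum>z\<in>Z. \<psi> z x) = 1"
    and "\<And>x. cmod x \<le> 1 \<Longrightarrow> cmod (x - (\<Sum>z\<in>Z. z * \<psi> z x)) \<le> e"
proof -
  obtain Z where Z: "finite Z" "Z \<subseteq> cball (0::complex) 1" "cball 0 1 \<subseteq> (\<Union>z\<in>Z. ball z e)"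
    using compact_imp_seq_compact[OF compact_cball] seq_compact_imp_totally_bounded e by metis
  define bump where "bump z x = max 0 (e - dist x z)" for z x :: complex
  define total where "total x = (\<Sum>z\<in>Z. bump z x)" for x
  define \<psi> where "\<psi> z x = bump z x / total x" for z x
  have bump0: "0 \<le> bump z x" for z x by (simp add: bump_def)
  have pos: "0 < total x" if "cmod x \<le> 1" for x
  proof -
    obtain z where "z \<in> Z" "dist z x < e" using Z(3) \<open>cmod x \<le> 1\<close> by fastforce
    then show ?thesis
      unfolding total_def using Z(1) bump0
      by (intro sum_pos2[of Z z]) (auto simp: bump_def dist_commute)
  qed
  have sum1: "(\<Sum>z\<in>Z. \<psi> z x) = 1" if "cmod x \<le> 1" for x
    using pos[OF that] by (simp add: \<psi>_def total_def flip: sum_divide_distrib)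
  have \<psi>0: "0 \<le> \<psi> z x" for z x
    using bump0 by (simp add: \<psi>_def total_def sum_nonneg)
  show thesis
  proof
    show "finite Z" by fact
    show "\<And>z. z \<in> Z \<Longrightarrow> cmod z \<le> 1" using Z(2) by auto
    show "continuous_on (cball 0 1) (\<psi> z)" for z
    proof -
      have "\<forall>x\<in>cball 0 1. total x \<noteq> 0" using pos by force
      then show ?thesis
        unfolding \<psi>_def bump_def total_def by (intro continuous_intros)
    qed
    show "\<And>z x. 0 \<le> \<psi> z x" by (rule \<psi>0)
    show "\<And>x. cmod x \<le> 1 \<Longrightarrow> (\<Sum>z\<in>Z. \<psi> z x) = 1" by (rule sum1)
    show "cmod (x - (\<Sum>z\<in>Z. z * \<psi> z x)) \<le> e" if x: "cmod x \<le> 1" for x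
    proof -
      \<comment> \<open>Averaging the constant \<open>x\<close> with the same weights turns the
        error into a mean of the differences \<open>x - z\<close>.\<close>
      have "x = x * of_real (\<Sum>z\<in>Z. \<psi> z x)" using sum1[OF x] by simp
      then have "x - (\<Sum>z\<in>Z. z * \<psi> z x) = (\<Sum>z\<in>Z. (x - z) * \<psi> z x)"
        by (simp add: sum_distrib_left left_diff_distrib sum_subtractf)
      also have "cmod \<dots> \<le> (\<Sum>z\<in>Z. e * \<psi> z x)"
      proof (rule sum_norm_le)
        fix z
        show "cmod ((x - z) * \<psi> z x) \<le> e * \<psi> z x"
        proof (cases "\<psi> z x = 0")
          case False
          then have "dist x z < e" by (auto simp: \<psi>_def bump_def)
          then show ?thesis
            using \<psi>0[of z x] by (simp add: norm_mult dist_norm mult_right_mono)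
        qed simp
      qed
      also have "\<dots> = e" using sum1[OF x] by (simp flip: sum_distrib_left)
      finally show ?thesis .
    qed
  qed
qed

text \<open>Boundedness of the functional makes the supremum in \<open>measure_norm\<close> an
  actual upper bound.\<close>

lemma cmod_signed_integral_le_measure_norm:
  assumes "real_borel_measure X \<mu>" and "f \<in> C_unit_ball X"
  shows "cmod (signed_integral X \<mu> f) \<le> measure_norm X \<mu>"
proof -
  obtain K where K: "\<And>f B. continuous_map X euclidean f \<Longrightarrow>
    (\<And>x. x \<in> topspace X \<Longrightarrow> cmod (f x) \<le> B) \<Longrightarrow> cmod (signed_integral X \<mu> f) \<le> K * B"
    using signed_integral_bounded assms(1) by metis
  have "bdd_above ((\<lambda>f. cmod (signed_integral X \<mu> f)) ` C_unit_ball X)"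
    by (rule bdd_aboveI2[of _ _ "K * 1"]) (rule K, auto simp: C_unit_ball_def)
  then show ?thesis
    unfolding measure_norm_def C_op_norm_def using assms(2) by (rule cSUP_upper2) simp
qed

lemma zero_in_C_unit_ball: "(\<lambda>_. 0) \<in> C_unit_ball X"
  by (simp add: C_unit_ball_def)

text \<open>Multiplying each \<open>\<phi> z\<close> by the conjugate sign of its integral makes the
  integrals add up in absolute value; the resulting sum \<open>g\<close> stays in the unit ball
  because the \<open>\<phi> z\<close> are nonnegative with sum 1.\<close>

lemma sum_partition_le_measure_norm:
  fixes \<phi> :: "'b \<Rightarrow> 'a \<Rightarrow> real"
  assumes \<mu>: "real_borel_measure X \<mu>" and Z: "finite Z"
    and cont: "\<And>z. z \<in> Z \<Longrightarrow> continuous_map X euclideanreal (\<phi> z)"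
    and nonneg: "\<And>z x. 0 \<le> \<phi> z x"
    and sum1: "\<And>x. x \<in> topspace X \<Longrightarrow> (\<Sum>z\<in>Z. \<phi> z x) = 1"
  shows "(\<Sum>z\<in>Z. cmod (signed_integral X \<mu> (\<lambda>x. \<phi> z x))) \<le> measure_norm X \<mu>"
proof -
  let ?l = "\<lambda>z. signed_integral X \<mu> (\<lambda>x. \<phi> z x)"
  define g where "g x = (\<Sum>z\<in>Z. cnj (sgn (?l z)) * complex_of_real (\<phi> z x))" for x
  have contc: "continuous_map X euclidean (\<lambda>x. complex_of_real (\<phi> z x))" if "z \<in> Z" for z
    using continuous_map_mult_of_real[OF cont[OF that], of 1] by simp
  have le1: "\<phi> z x \<le> 1" if "z \<in> Z" "x \<in> topspace X" for z x
    using member_le_sum[of z Z "\<lambda>z. \<phi> z x"] sum1 nonneg Z that by auto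
  have "g \<in> C_unit_ball X"
  proof -
    have "continuous_map X euclidean g"
      unfolding g_def by (intro continuous_map_sum continuous_map_mult_of_real cont Z)
    moreover have "cmod (g x) \<le> 1" if "x \<in> topspace X" for x
    proof -
      have "cmod (g x) \<le> (\<Sum>z\<in>Z. \<phi> z x)"
        unfolding g_def using nonneg by (intro sum_norm_le) (simp add: norm_mult norm_sgn)
      then show ?thesis using sum1 that by simp
    qed
    ultimately show ?thesis by (simp add: C_unit_ball_def)
  qed
  moreover have "signed_integral X \<mu> g = of_real (\<Sum>z\<in>Z. cmod (?l z))"
  proof -
    have "signed_integral X \<mu> g = (\<Sum>z\<in>Z. cnj (sgn (?l z)) * ?l z)"
      unfolding g_def using contc le1 nonneg by (intro signed_integral_sum[OF \<mu>, of _ _ 1]) auto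
    also have "\<dots> = (\<Sum>z\<in>Z. of_real (cmod (?l z)))"
    proof (rule sum.cong)
      show "cnj (sgn (?l z)) * ?l z = of_real (cmod (?l z))" for z
        using complex_norm_square[of "?l z"]
        by (cases "?l z = 0") (auto simp: sgn_eq power2_eq_square field_simps)
    qed simp
    finally show ?thesis by simp
  qed
  ultimately have "cmod (of_real (\<Sum>z\<in>Z. cmod (?l z))) \<le> measure_norm X \<mu>"
    using cmod_signed_integral_le_measure_norm[OF \<mu>] by metis
  then show ?thesis
    unfolding norm_of_real by (rule order_trans[OF abs_ge_self])
qed

section \<open>The quotient norm and its dual description\<close>

lemma quotient_norm_le: "quotient_norm (coset_one v) \<le> max_norm (v + z *s 1)"
proof -
  have "0 \<le> max_norm w" for w
    unfolding max_norm_def by (rule order_trans[OF norm_ge_zero[of "w $ 1"]]) (auto intro!: Max_ge)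
  then have "bdd_below (max_norm ` coset_one v)" by (intro bdd_belowI[of _ 0]) auto
  then show ?thesis
    unfolding quotient_norm_def by (intro cINF_lower) (auto simp: coset_one_def)
qed

text \<open>Differences of coordinates are the same for all representatives of a coset, and each is
  at most twice the maximum norm of any of them.\<close>

lemma cmod_diff_le_quotient_norm: "cmod (v $ j - v $ k) \<le> 2 * quotient_norm (coset_one v)"
proof -
  have "cmod (v $ j - v $ k) / 2 \<le> quotient_norm (coset_one v)"
    unfolding quotient_norm_def
  proof (rule cINF_greatest)
    show "coset_one v \<noteq> {}" by (auto simp: coset_one_def)
    fix w assume "w \<in> coset_one v"
    then have d: "v $ j - v $ k = w $ j - w $ k"
      by (auto simp: coset_one_def)
    have "cmod (w $ i) \<le> max_norm w" for i
      unfolding max_norm_def by (auto intro!: Max_ge)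
    from this[of j] this[of k] show "cmod (v $ j - v $ k) / 2 \<le> max_norm w"
      unfolding d using norm_triangle_ineq4[of "w $ j" "w $ k"] by linarith
  qed
  then show ?thesis by simp
qed

text \<open>\<open>enclosing_disc_dual\<close> for three points, read off at the representative
  \<open>v + (- z) *s 1\<close>. As the weights sum to 0, the weighted sum depends only on the
  coset.\<close>

lemma quotient_norm_dual:
  obtains w :: "3 \<Rightarrow> complex" where "w 1 + w 2 + w 3 = 0"
    and "cmod (w 1) + cmod (w 2) + cmod (w 3) \<le> 1"
    and "quotient_norm (coset_one v) \<le> cmod (w 1 * v $ 1 + w 2 * v $ 2 + w 3 * v $ 3)"
proof -
  obtain z w where w: "(\<Sum>j\<in>UNIV. w j) = 0" "(\<Sum>j\<in>UNIV. cmod (w j)) \<le> 1"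
    "\<And>j. cmod (v $ j - z) \<le> cmod (\<Sum>j\<in>UNIV. w j * v $ j)"
    using enclosing_disc_dual[of "\<lambda>j. v $ j"] by metis
  have "max_norm (v + (- z) *s 1) \<le> cmod (\<Sum>j\<in>UNIV. w j * v $ j)"
    unfolding max_norm_def using w(3) by (intro Max.boundedI) auto
  then have "quotient_norm (coset_one v) \<le> cmod (\<Sum>j\<in>UNIV. w j * v $ j)"
    using quotient_norm_le order_trans by blast
  then show thesis using w that[of w] by (simp add: sum_3)
qed

text \<open>\<open>cut_inequality\<close> with functionals in place of numbers: it is applied to the
  three integrals of each \<open>\<phi> z\<close>, and \<open>sum_partition_le_measure_norm\<close>
  bounds the sums over \<open>z\<close>. The error of approximating \<open>f\<close> by
  \<open>s\<close> vanishes with \<open>e\<close>.\<close>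

lemma weighted_integrals_bound:
  fixes \<mu> :: "3 \<Rightarrow> 'a set \<Rightarrow> real" and w :: "3 \<Rightarrow> complex"
  assumes \<mu>: "\<And>j. real_borel_measure X (\<mu> j)" and f: "f \<in> C_unit_ball X"
    and w: "w 1 + w 2 + w 3 = 0"
  defines "N j k \<equiv> measure_norm X (\<mu> j - \<mu> k)"
  defines "l j \<equiv> signed_integral X (\<mu> j)"
  shows "2 * cmod (w 1 * l 1 f + w 2 * l 2 f + w 3 * l 3 f) \<le>
    (cmod (w 1) + cmod (w 2) - cmod (w 3)) * N 1 2 + (cmod (w 1) + cmod (w 3) - cmod (w 2)) * N 1 3
      + (cmod (w 2) + cmod (w 3) - cmod (w 1)) * N 2 3"
proof -
  define c where "c = cmod (w 1) + cmod (w 2) - cmod (w 3)"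
  define c' where "c' = cmod (w 1) + cmod (w 3) - cmod (w 2)"
  define c'' where "c'' = cmod (w 2) + cmod (w 3) - cmod (w 1)"
  have c0: "0 \<le> c" "0 \<le> c'" "0 \<le> c''"
    unfolding c_def c'_def c''_def
    using cmod_le_add_of_sum_zero[of "w 1" "w 2" "w 3"] cmod_le_add_of_sum_zero[of "w 2" "w 1" "w 3"]
      cmod_le_add_of_sum_zero[of "w 3" "w 1" "w 2"] w by (simp_all add: ac_simps)
  have fc: "continuous_map X euclidean f" and f1: "\<And>x. x \<in> topspace X \<Longrightarrow> cmod (f x) \<le> 1"
    using f by (auto simp: C_unit_ball_def)
  have "\<exists>K\<ge>0. \<forall>g B. continuous_map X euclidean g \<longrightarrow> (\<forall>x\<in>topspace X. cmod (g x) \<le> B) \<longrightarrow>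
    cmod (l j g) \<le> K * B" for j
    unfolding l_def by (rule signed_integral_bounded[OF \<mu>[of j]]) blast
  then obtain K where K0: "\<And>j. 0 \<le> K j" and K: "\<And>j g B. continuous_map X euclidean g \<Longrightarrow>
    (\<And>x. x \<in> topspace X \<Longrightarrow> cmod (g x) \<le> B) \<Longrightarrow> cmod (l j g) \<le> K j * B"
    by metis
  \<comment> \<open>The same combination is formed of the integrals of \<open>f\<close>,
    \<open>s\<close>, \<open>f - s\<close> and each \<open>\<phi> z\<close>; \<open>M\<close> bounds
    it for integrands bounded by 1.\<close>
  define W where "W F = w 1 * F 1 + w 2 * F 2 + w 3 * F 3" for F :: "3 \<Rightarrow> complex"
  define M where "M = cmod (w 1) * K 1 + cmod (w 2) * K 2 + cmod (w 3) * K 3"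
  have M0: "0 \<le> M" using K0 by (simp add: M_def)
  have bound: "2 * cmod (W (\<lambda>j. l j f)) \<le> c * N 1 2 + c' * N 1 3 + c'' * N 2 3 + 2 * (M * e)"
    if e: "0 < e" for e
  proof -
    obtain Z \<psi> where Z: "finite Z" and Z1: "\<And>z. z \<in> Z \<Longrightarrow> cmod z \<le> 1"
      and \<psi>c: "\<And>z. continuous_on (cball 0 1) (\<psi> z)" and \<psi>0: "\<And>z x. 0 \<le> \<psi> z x"
      and \<psi>1: "\<And>x. cmod x \<le> 1 \<Longrightarrow> (\<Sum>z\<in>Z. \<psi> z x) = 1"
      and \<psi>e: "\<And>x. cmod x \<le> 1 \<Longrightarrow> cmod (x - (\<Sum>z\<in>Z. z * complex_of_real (\<psi> z x))) \<le> e"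
      by (rule disc_partition_of_unity[OF e]) (rule that)
    \<comment> \<open>The partition of the disc is pulled back to \<open>X\<close>, which is
      possible because \<open>f\<close> maps into the disc.\<close>
    define \<phi> where "\<phi> z x = \<psi> z (f x)" for z x
    have \<phi>c: "continuous_map X euclideanreal (\<phi> z)" for z
    proof -
      have "continuous_map X (top_of_set (cball 0 1)) f"
        using fc f1 by (auto simp: continuous_map_in_subtopology)
      moreover have "continuous_map (top_of_set (cball 0 1)) euclideanreal (\<psi> z)"
        using \<psi>c by simp
      ultimately show ?thesis
        using continuous_map_compose[of X _ f euclideanreal "\<psi> z"] by (simp add: \<phi>_def[abs_def] o_def)
    qed
    have \<phi>0: "\<And>z x. 0 \<le> \<phi> z x" by (simp add: \<phi>_def \<psi>0)
    have \<phi>1: "(\<Sum>z\<in>Z. \<phi> z x) = 1" if "x \<in> topspace X" for x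
      using that \<psi>1 f1 by (simp add: \<phi>_def)
    have \<phi>cc: "continuous_map X euclidean (\<lambda>x. complex_of_real (\<phi> z x))" for z
      using continuous_map_mult_of_real[OF \<phi>c, of 1] by simp
    have \<phi>le: "\<phi> z x \<le> 1" if "z \<in> Z" "x \<in> topspace X" for z x
      using member_le_sum[of z Z "\<lambda>z. \<phi> z x"] \<phi>1 \<phi>0 Z that by auto
    define s where "s x = (\<Sum>z\<in>Z. z * complex_of_real (\<phi> z x))" for x
    have sc: "continuous_map X euclidean s"
      unfolding s_def by (intro continuous_map_sum continuous_map_mult_of_real \<phi>c Z)
    have fs: "cmod (f x - s x) \<le> e" if "x \<in> topspace X" for x
      using that \<psi>e f1 by (simp add: s_def \<phi>_def)
    \<comment> \<open>This bound secures the integrability of \<open>s\<close>.\<close>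
    have s1: "cmod (s x) \<le> 1 + e" if "x \<in> topspace X" for x
      using fs[OF that] f1[OF that] norm_triangle_ineq4[of "f x" "f x - s x"] by simp
    have ls: "l j s = (\<Sum>z\<in>Z. z * l j (\<lambda>x. \<phi> z x))" for j
      unfolding s_def l_def using \<phi>cc \<phi>le \<phi>0 by (intro signed_integral_sum[OF \<mu>, of _ _ 1]) auto
    have lf: "l j f = l j s + l j (\<lambda>x. f x - s x)" for j
      unfolding l_def using signed_integral_diff[OF \<mu> fc f1 sc s1] by simp
    have "cmod (W (\<lambda>j. l j (\<lambda>x. f x - s x))) \<le> cmod (w 1) * (K 1 * e) + cmod (w 2) * (K 2 * e) + cmod (w 3) * (K 3 * e)"
      unfolding W_def
      by (intro norm_triangle_mono) (auto simp: norm_mult intro!: mult_left_mono K continuous_map_diff fc sc fs)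
    then have err: "cmod (W (\<lambda>j. l j (\<lambda>x. f x - s x))) \<le> M * e"
      by (simp add: M_def algebra_simps)
    \<comment> \<open>Integrals of real functions are real, so \<open>cut_inequality\<close> applies
      to the numbers \<open>g j z\<close>.\<close>
    define g where "g j z = Re (l j (\<lambda>x. \<phi> z x))" for j z
    have lg: "l j (\<lambda>x. \<phi> z x) = g j z" for j z
      unfolding l_def g_def by (rule of_real_Re[symmetric]) (rule signed_integral_of_real)
    have gN: "(\<Sum>z\<in>Z. \<bar>g j z - g k z\<bar>) \<le> N j k" for j k
    proof -
      have "signed_integral X (\<mu> j - \<mu> k) (\<lambda>x. \<phi> z x) = g j z - g k z" if "z \<in> Z" for z
        using signed_integral_measure_diff[OF \<mu> \<mu> \<phi>cc, of z 1 j k] \<phi>le \<phi>0 that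
        by (simp add: lg[unfolded l_def])
      then have "(\<Sum>z\<in>Z. \<bar>g j z - g k z\<bar>) = (\<Sum>z\<in>Z. cmod (signed_integral X (\<mu> j - \<mu> k) (\<lambda>x. \<phi> z x)))"
        by (intro sum.cong) (simp_all flip: of_real_diff)
      also have "\<dots> \<le> N j k"
        unfolding N_def by (intro sum_partition_le_measure_norm real_borel_measure_diff \<mu> Z \<phi>c \<phi>0 \<phi>1)
      finally show ?thesis .
    qed
    have "W (\<lambda>j. l j s) = (\<Sum>z\<in>Z. z * W (\<lambda>j. g j z))"
      by (simp add: W_def ls lg sum_distrib_left sum.distrib algebra_simps)
    \<comment> \<open>The factors \<open>z\<close> disappear because they lie in the unit
      disc.\<close>
    also have "2 * cmod \<dots> \<le> (\<Sum>z\<in>Z. 2 * cmod (W (\<lambda>j. g j z)))"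
      unfolding sum_distrib_left[symmetric]
      by (intro mult_left_mono sum_norm_le) (auto simp: norm_mult intro!: mult_left_le_one_le Z1)
    also have "\<dots> \<le> (\<Sum>z\<in>Z. c * \<bar>g 1 z - g 2 z\<bar> + c' * \<bar>g 1 z - g 3 z\<bar> + c'' * \<bar>g 2 z - g 3 z\<bar>)"
      unfolding W_def c_def c'_def c''_def by (intro sum_mono cut_inequality w)
    also have "\<dots> \<le> c * N 1 2 + c' * N 1 3 + c'' * N 2 3"
      unfolding sum.distrib sum_distrib_left[symmetric] by (intro add_mono mult_left_mono gN c0)
    finally have "2 * cmod (W (\<lambda>j. l j s)) \<le> c * N 1 2 + c' * N 1 3 + c'' * N 2 3" .
    moreover have "W (\<lambda>j. l j f) = W (\<lambda>j. l j s) + W (\<lambda>j. l j (\<lambda>x. f x - s x))"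
      unfolding W_def lf by (simp add: algebra_simps)
    ultimately show ?thesis
      using err norm_triangle_ineq[of "W (\<lambda>j. l j s)" "W (\<lambda>j. l j (\<lambda>x. f x - s x))"] by simp
  qed
  have "2 * cmod (W (\<lambda>j. l j f)) \<le> c * N 1 2 + c' * N 1 3 + c'' * N 2 3"
  proof (rule field_le_epsilon)
    fix d :: real assume d: "0 < d"
    \<comment> \<open>The \<open>+ 1\<close> keeps the denominator positive when
      \<open>M = 0\<close>.\<close>
    have "2 * (M * (d / (2 * (M + 1)))) \<le> d"
      using M0 d by (simp add: field_simps)
    then show "2 * cmod (W (\<lambda>j. l j f)) \<le> c * N 1 2 + c' * N 1 3 + c'' * N 2 3 + d"
      using bound[of "d / (2 * (M + 1))"] M0 d by simp
  qed
  then show ?thesis by (simp add: W_def c_def c'_def c''_def)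
qed

theorem theorem7:
  fixes X :: "'a topology" and \<mu> :: "3 \<Rightarrow> 'a set \<Rightarrow> real"
  assumes "compact_space X" and "Hausdorff_space X"
    and "\<And>j. real_borel_measure X (\<mu> j)"
  shows "C_op_norm X quotient_norm (integral_triple X \<mu>)
       = 1 / 2 * Max {measure_norm X (\<mu> j - \<mu> k) | j k. True}"
proof -
  define N where "N j k = measure_norm X (\<mu> j - \<mu> k)" for j k
  define m where "m = Max {N j k | j k. True}"
  have fin: "finite {N j k | j k. True}"
    using finite_image_set2[of "\<lambda>_. True" "\<lambda>_. True" N] by simp
  have Nm: "N j k \<le> m" for j k
    unfolding m_def by (rule Max_ge[OF fin]) blast
  have upper: "quotient_norm (integral_triple X \<mu> f) \<le> 1 / 2 * m" if f: "f \<in> C_unit_ball X" for f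
  proof -
    let ?v = "\<chi> j. signed_integral X (\<mu> j) f"
    obtain w :: "3 \<Rightarrow> complex" where w: "w 1 + w 2 + w 3 = 0" "cmod (w 1) + cmod (w 2) + cmod (w 3) \<le> 1"
      and q: "quotient_norm (coset_one ?v) \<le> cmod (w 1 * ?v $ 1 + w 2 * ?v $ 2 + w 3 * ?v $ 3)"
      by (rule quotient_norm_dual[of ?v]) (rule that)
    have nn: "cmod (w 1) \<le> cmod (w 2) + cmod (w 3)" "cmod (w 2) \<le> cmod (w 1) + cmod (w 3)"
      "cmod (w 3) \<le> cmod (w 1) + cmod (w 2)"
      using w(1) by (auto intro!: cmod_le_add_of_sum_zero simp: ac_simps)
    \<comment> \<open>Replacing the sum of the \<open>cmod (w j)\<close> by 1 requires
      \<open>0 \<le> m\<close>; testing with the zero function gives it.\<close>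
    have "0 \<le> N 1 1"
      unfolding N_def
      by (rule order_trans[OF norm_ge_zero cmod_signed_integral_le_measure_norm[OF
            real_borel_measure_diff[OF assms(3) assms(3)] zero_in_C_unit_ball]])
    then have m0: "0 \<le> m" using Nm[of 1 1] by linarith
    have "2 * cmod (w 1 * ?v $ 1 + w 2 * ?v $ 2 + w 3 * ?v $ 3) \<le>
      (cmod (w 1) + cmod (w 2) - cmod (w 3)) * N 1 2 + (cmod (w 1) + cmod (w 3) - cmod (w 2)) * N 1 3
      + (cmod (w 2) + cmod (w 3) - cmod (w 1)) * N 2 3"
      using weighted_integrals_bound[OF assms(3) f w(1)] by (simp add: N_def)
    \<comment> \<open>By \<open>nn\<close> the three coefficients are nonnegative, and they add up
      to the sum of the \<open>cmod (w j)\<close>.\<close>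
    also have "\<dots> \<le> (cmod (w 1) + cmod (w 2) - cmod (w 3)) * m + (cmod (w 1) + cmod (w 3) - cmod (w 2)) * m
      + (cmod (w 2) + cmod (w 3) - cmod (w 1)) * m"
      using nn by (intro add_mono mult_left_mono Nm) auto
    also have "\<dots> = (cmod (w 1) + cmod (w 2) + cmod (w 3)) * m" by (simp add: algebra_simps)
    also have "\<dots> \<le> m" using w(2) m0 by (simp add: mult_left_le_one_le)
    finally show ?thesis using q by (simp add: integral_triple_def)
  qed
  have "C_op_norm X quotient_norm (integral_triple X \<mu>) \<le> 1 / 2 * m"
    unfolding C_op_norm_def using upper zero_in_C_unit_ball by (intro cSUP_least) blast+
  moreover have "m \<le> 2 * C_op_norm X quotient_norm (integral_triple X \<mu>)"
  proof -
    \<comment> \<open>The bound \<open>upper\<close> also makes the supremum in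
      \<open>C_op_norm\<close> a genuine one.\<close>
    have "bdd_above ((\<lambda>f. quotient_norm (integral_triple X \<mu> f)) ` C_unit_ball X)"
      using upper by (intro bdd_aboveI2)
    then have L: "quotient_norm (integral_triple X \<mu> f) \<le> C_op_norm X quotient_norm (integral_triple X \<mu>)"
      if "f \<in> C_unit_ball X" for f
      unfolding C_op_norm_def using that by (intro cSUP_upper)
    \<comment> \<open>The integral against \<open>\<mu> j - \<mu> k\<close> is a difference of two
      coordinates of the triple, hence at most twice its quotient norm.\<close>
    have "N j k \<le> 2 * C_op_norm X quotient_norm (integral_triple X \<mu>)" for j k
      unfolding N_def measure_norm_def C_op_norm_def[of X cmod]
    proof (rule cSUP_least)
      show "C_unit_ball X \<noteq> {}" using zero_in_C_unit_ball by blast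
      fix f assume f: "f \<in> C_unit_ball X"
      then have "signed_integral X (\<mu> j - \<mu> k) f = signed_integral X (\<mu> j) f - signed_integral X (\<mu> k) f"
        by (intro signed_integral_measure_diff[OF assms(3) assms(3), of f 1]) (auto simp: C_unit_ball_def)
      then show "cmod (signed_integral X (\<mu> j - \<mu> k) f) \<le> 2 * C_op_norm X quotient_norm (integral_triple X \<mu>)"
        using cmod_diff_le_quotient_norm[of "\<chi> j. signed_integral X (\<mu> j) f" j k] L[OF f]
        by (simp add: integral_triple_def)
    qed
    then show ?thesis unfolding m_def by (subst Max_le_iff[OF fin]) auto
  qed
  ultimately show ?thesis by (simp add: m_def N_def)
qed

end
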